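(* Let $R$ be a subset of $\mathbb{R}^2$ with nonempty interior and let $T=(f,g):R\to R$ be a map of class $C^p$ for some $p\ge 1$. Suppose that $T$ has a fixed point $(\overline{x},\overline{y})\in\operatorname{int} R$ such that the numbers $$a:=f_x(\overline{x},\overline{y}),\quad b:=f_y(\overline{x},\overline{y}),\quad c:=g_x(\overline{x},\overline{y}),\quad d:=g_y(\overline{x},\overline{y})$$ satisfy $$0<a<1,\qquad bc>0,\qquad 0<d<1,\qquad 1+(a+d)+ad-bc>0 .$$ Let $C_1$, $C_2$ be the critical sets $C_1:=\{(x,y): x=f(x,y)\}$ and $C_2:=\{(x,y): y=g(x,y)\}$. Then: (i) There exist neighborhoods $I\subset\mathbb{R}$ of $\overline{x}$ and $J\subset\mathbb{R}$ of $\overline{y}$ such that the sets $C_1\cap(I\times J)$ and $C_2\cap(I\times J)$ are the graphs of class $C^p$ functions $y_1(x)$ and $y_2(x)$, respectively, for $x\in I$. (ii) The eigenvalues $\lambda_1,\lambda_2$ of the Jacobian matrix of $T$ at $(\overline{x},\overline{y})$ are real and distinct, and the eigenvalue with larger absolute value is positive. If $\lambda_1$ is the larger eigenvalue, then $-1<\lambda_2<1$ and $$\operatorname{sign}(\lambda_1-1)=\begin{cases}-\operatorname{sign}\big(y_1'(\overline{x})-y_2'(\overline{x})\big) & \text{if } b<0,\\[2pt] \operatorname{sign}\big(y_1'(\overline{x})-y_2'(\overline{x})\big) & \text{if } b>0.\end{cases}$$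
   Context: Subscripts $x,y$ on $f,g$ denote partial derivatives. $\operatorname{sign}(t)\in\{-1,0,1\}$ is the usual sign of a real number $t$. $C_1$ and $C_2$ are subsets of $R$.
   Formalization: The printed sign formula is false (e.g. T(x,y)=(x/2+y/10, x/10+y/2) at the origin); the cases b<0 and b>0 are interchanged: sign(λ1−1) equals sign(y1'−y2') if b<0 and −sign(y1'−y2') if b>0. *)

theory Defs
  imports "HOL-Analysis.Analysis" "Jordan_Normal_Form.Char_Poly"
begin

text \<open>Class \<open>C\<^sup>k\<close> on an open set: \<open>f\<close> is differentiable and all its directional derivatives are
  of class \<open>C\<^sup>k\<^sup>-\<^sup>1\<close>. In finite dimension this is the usual notion (all partial derivatives
  up to order \<open>k\<close> exist and are continuous). It is meant for open \<open>U\<close> only.\<close>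

primrec Ck_on_open ::
  "nat \<Rightarrow> ('a::euclidean_space \<Rightarrow> 'b::euclidean_space) \<Rightarrow> 'a set \<Rightarrow> bool" where
  "Ck_on_open 0 f U \<longleftrightarrow> continuous_on U f"
| "Ck_on_open (Suc k) f U \<longleftrightarrow>
     (\<forall>x\<in>U. f differentiable (at x)) \<and>
     (\<forall>v. Ck_on_open k (\<lambda>x. frechet_derivative f (at x) v) U)"

text \<open>Class \<open>C\<^sup>k\<close> on an arbitrary set \<open>S\<close>: near every point of \<open>S\<close>, \<open>f\<close> is the restriction
  to \<open>S\<close> of a \<open>C\<^sup>k\<close> map on an open set. The values of \<open>f\<close> outside \<open>S\<close> are irrelevant.\<close>

definition Ck_on ::
  "nat \<Rightarrow> ('a::euclidean_space \<Rightarrow> 'b::euclidean_space) \<Rightarrow> 'a set \<Rightarrow> bool" where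
  "Ck_on k f S \<longleftrightarrow>
     (\<forall>x\<in>S. \<exists>U h. open U \<and> x \<in> U \<and> Ck_on_open k h U \<and> (\<forall>z\<in>S \<inter> U. h z = f z))"

definition partial_x :: "(real \<times> real \<Rightarrow> real) \<Rightarrow> real \<times> real \<Rightarrow> real" where
  "partial_x f z = deriv (\<lambda>x. f (x, snd z)) (fst z)"

definition partial_y :: "(real \<times> real \<Rightarrow> real) \<Rightarrow> real \<times> real \<Rightarrow> real" where
  "partial_y f z = deriv (\<lambda>y. f (fst z, y)) (snd z)"

definition jacobian_matrix :: "(real \<times> real \<Rightarrow> real \<times> real) \<Rightarrow> real \<times> real \<Rightarrow> real mat" where
  "jacobian_matrix T z = mat_of_rows_list 2
     [[partial_x (\<lambda>w. fst (T w)) z, partial_y (\<lambda>w. fst (T w)) z],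
      [partial_x (\<lambda>w. snd (T w)) z, partial_y (\<lambda>w. snd (T w)) z]]"

text \<open>All eigenvalues, including possible non-real ones.\<close>

definition complex_eigenvalues :: "real mat \<Rightarrow> complex set" where
  "complex_eigenvalues A = {\<mu>. eigenvalue (map_mat complex_of_real A) \<mu>}"

definition Ck_graph_in ::
  "nat \<Rightarrow> (real \<times> real) set \<Rightarrow> real set \<Rightarrow> real set \<Rightarrow> (real \<Rightarrow> real) \<Rightarrow> bool" where
  "Ck_graph_in k C I J y \<longleftrightarrow> Ck_on_open k y I \<and> C \<inter> (I \<times> J) = {(x, y x) | x. x \<in> I}"

end

theory Submission
  imports Defs
begin

text \<open>The hypotheses give \<open>b \<noteq> 0\<close> and \<open>d \<noteq> 1\<close>, so the implicit function theorem solves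
  \<open>f (x, y) - x = 0\<close> and \<open>g (x, y) - y = 0\<close> for \<open>y\<close> near the fixed point, and differentiating gives
  \<open>y1' = (1 - a) / b\<close> and \<open>y2' = c / (1 - d)\<close>. With the characteristic polynomial
  \<open>q t = (t - a) (t - d) - b c\<close> this means \<open>b (1 - d) (y1' - y2') = q 1 = (1 - l1) (1 - l2)\<close>.
  The discriminant \<open>(a - d)\<^sup>2 + 4 b c\<close> is positive, \<open>0 < l1 + l2 = a + d < 2\<close> and \<open>q (- 1) > 0\<close>,
  so the eigenvalues are real and distinct, \<open>l1\<close> dominates and \<open>\<bar>l2\<bar> < 1\<close>; hence \<open>1 - l1\<close>
  has the sign of \<open>b (y1' - y2')\<close>.

  The implicit function is obtained by the intermediate value theorem and strict monotonicity of
  \<open>F (x, \<cdot>)\<close>; it is differentiable because \<open>(x, y) \<mapsto> (x, F (x, y))\<close> has a differentiable inverse,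
  and the formula \<open>y' = - F_x / F_y\<close> then lifts it to class \<open>C\<^sup>k\<close> by induction on \<open>k\<close>.\<close>

section \<open>Calculus of functions of class C^k on open sets\<close>

lemma Ck_on_open_subset:
  "Ck_on_open k f U \<Longrightarrow> V \<subseteq> U \<Longrightarrow> Ck_on_open k f V"
  by (induction k arbitrary: f) (auto intro: continuous_on_subset)

text \<open>Openness of \<open>U\<close> makes the derivative at a point of \<open>U\<close> depend
  only on values on \<open>U\<close>, so the agreement passes to all directional
  derivatives.\<close>

lemma Ck_on_open_cong:
  assumes "open U" "\<And>x. x \<in> U \<Longrightarrow> f x = g x" "Ck_on_open k f U"
  shows "Ck_on_open k g U"
  using assms(2,3)
proof (induction k arbitrary: f g)
  case 0
  then show ?case by (auto intro: continuous_on_eq)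
next
  case (Suc k)
  have fd: "f differentiable (at x)" if "x \<in> U" for x
    using Suc.prems that by auto
  have "g differentiable (at x)" if "x \<in> U" for x
    using fd[OF that] Deriv.has_derivative_transform_within_open[where f = f and g = g, OF _ assms(1) that Suc.prems(1)]
    unfolding differentiable_def by blast
  moreover have "Ck_on_open k (\<lambda>x. frechet_derivative g (at x) v) U" for v
  proof (rule Suc.IH)
    show "Ck_on_open k (\<lambda>x. frechet_derivative f (at x) v) U" using Suc.prems by simp
    show "frechet_derivative f (at x) v = frechet_derivative g (at x) v" if "x \<in> U" for x
      using frechet_derivative_transform_within_open[OF fd[OF that] assms(1) that Suc.prems(1)]
      by simp
  qed
  ultimately show ?case by simp
qed

lemma Ck_on_open_imp_continuous_on:
  "Ck_on_open k f U \<Longrightarrow> continuous_on U f"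
  by (cases k)
    (auto intro!: continuous_at_imp_continuous_on differentiable_imp_continuous_within)

lemma Ck_on_open_SucD:
  "Ck_on_open (Suc k) f U \<Longrightarrow> Ck_on_open k f U"
proof (induction k arbitrary: f)
  case 0
  then show ?case using Ck_on_open_imp_continuous_on[of "Suc 0"] by simp
next
  case (Suc k)
  then show ?case by (metis Ck_on_open.simps(2))
qed

text \<open>By uniqueness of the derivative, an explicit family \<open>D\<close> produced by
  differentiation rules may stand in for \<open>frechet_derivative\<close>.\<close>

lemma Ck_on_open_SucI:
  assumes "open U" "\<And>x. x \<in> U \<Longrightarrow> (f has_derivative D x) (at x)"
    and "\<And>v. Ck_on_open k (\<lambda>x. D x v) U"
  shows "Ck_on_open (Suc k) f U"
proof -
  have "Ck_on_open k (\<lambda>x. frechet_derivative f (at x) v) U" for v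
    by (rule Ck_on_open_cong[OF assms(1) _ assms(3)[of v]])
      (metis assms(2) frechet_derivative_at)
  then show ?thesis using assms(2) by (auto simp: differentiable_def)
qed

lemma Ck_on_open_SucE:
  assumes "Ck_on_open (Suc k) f U"
  obtains D where "\<And>x. x \<in> U \<Longrightarrow> (f has_derivative D x) (at x)"
    and "\<And>v. Ck_on_open k (\<lambda>x. D x v) U"
proof
  show "(f has_derivative frechet_derivative f (at x)) (at x)" if "x \<in> U" for x
    using assms that by (simp add: frechet_derivative_works)
  show "Ck_on_open k (\<lambda>x. frechet_derivative f (at x) v) U" for v
    using assms by simp
qed

lemma Ck_on_open_const: "open U \<Longrightarrow> Ck_on_open k (\<lambda>x. c) U"
proof (induction k arbitrary: c)
  case (Suc k)
  then show ?case by (intro Ck_on_open_SucI[where D = "\<lambda>_ _. 0"]) auto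
qed simp

lemma Ck_on_open_bounded_linear:
  assumes "open U" "bounded_linear L"
  shows "Ck_on_open k L U"
proof (cases k)
  case 0
  then show ?thesis using assms(2) by (simp add: linear_continuous_on)
next
  case (Suc n)
  show ?thesis unfolding Suc
    using bounded_linear_imp_has_derivative[OF assms(2)] Ck_on_open_const[OF assms(1)]
    by (intro Ck_on_open_SucI[OF assms(1), where D = "\<lambda>_. L"]) auto
qed

lemma Ck_on_open_linear_image:
  assumes "open U" "bounded_linear L" "Ck_on_open k f U"
  shows "Ck_on_open k (\<lambda>x. L (f x)) U"
  using assms(3)
proof (induction k arbitrary: f)
  case 0
  then show ?case
    using assms(2) by (auto intro: bounded_linear.continuous_on)
next
  case (Suc k)
  from Suc.prems obtain D where "\<And>x. x \<in> U \<Longrightarrow> (f has_derivative D x) (at x)"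
    and "\<And>v. Ck_on_open k (\<lambda>x. D x v) U"
    by (rule Ck_on_open_SucE) blast
  then show ?case
    by (intro Ck_on_open_SucI[OF assms(1), where D = "\<lambda>x v. L (D x v)"])
      (auto intro: Suc.IH bounded_linear.has_derivative[OF assms(2)])
qed

lemma Ck_on_open_add:
  assumes "open U" "Ck_on_open k f U" "Ck_on_open k g U"
  shows "Ck_on_open k (\<lambda>x. f x + g x) U"
  using assms(2,3)
proof (induction k arbitrary: f g)
  case 0
  then show ?case by (auto intro: continuous_on_add)
next
  case (Suc k)
  from Suc.prems(1) obtain D where D: "\<And>x. x \<in> U \<Longrightarrow> (f has_derivative D x) (at x)"
    "\<And>v. Ck_on_open k (\<lambda>x. D x v) U"
    by (rule Ck_on_open_SucE) blast
  from Suc.prems(2) obtain E where E: "\<And>x. x \<in> U \<Longrightarrow> (g has_derivative E x) (at x)"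
    "\<And>v. Ck_on_open k (\<lambda>x. E x v) U"
    by (rule Ck_on_open_SucE) blast
  show ?case
    by (rule Ck_on_open_SucI[OF assms(1), where D = "\<lambda>x v. D x v + E x v"])
      (auto intro: Suc.IH D E has_derivative_add)
qed

lemma Ck_on_open_diff:
  assumes "open U" "Ck_on_open k f U" "Ck_on_open k g U"
  shows "Ck_on_open k (\<lambda>x. f x - g x) U"
  using Ck_on_open_add[OF assms(1,2)
      Ck_on_open_linear_image[OF assms(1) bounded_linear_minus[OF bounded_linear_ident] assms(3)]]
  by simp

lemma Ck_on_open_sum:
  assumes "open U" "finite A" "\<And>i. i \<in> A \<Longrightarrow> Ck_on_open k (f i) U"
  shows "Ck_on_open k (\<lambda>x. \<Sum>i\<in>A. f i x) U"
  using assms(2,3)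
  by (induction A rule: finite_induct)
    (auto intro: Ck_on_open_add Ck_on_open_const assms(1))

text \<open>The product rule yields products of one function with a derivative of the other. All
  factors are of class C^k, so an induction hypothesis general in both \<open>f\<close> and
  \<open>g\<close> applies.\<close>

lemma Ck_on_open_scaleR:
  assumes "open U" "Ck_on_open k f U" "Ck_on_open k g U"
  shows "Ck_on_open k (\<lambda>x. f x *\<^sub>R g x) U"
  using assms(2,3)
proof (induction k arbitrary: f g)
  case 0
  then show ?case by (auto intro: continuous_on_scaleR)
next
  case (Suc k)
  from Suc.prems(1) obtain D where D: "\<And>x. x \<in> U \<Longrightarrow> (f has_derivative D x) (at x)"
    "\<And>v. Ck_on_open k (\<lambda>x. D x v) U"
    by (rule Ck_on_open_SucE) blast
  from Suc.prems(2) obtain E where E: "\<And>x. x \<in> U \<Longrightarrow> (g has_derivative E x) (at x)"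
    "\<And>v. Ck_on_open k (\<lambda>x. E x v) U"
    by (rule Ck_on_open_SucE) blast
  show ?case
    by (rule Ck_on_open_SucI[OF assms(1), where D = "\<lambda>x v. f x *\<^sub>R E x v + D x v *\<^sub>R g x"])
      (intro has_derivative_scaleR Ck_on_open_add[OF assms(1)] Suc.IH D E
        Ck_on_open_SucD[OF Suc.prems(1)] Ck_on_open_SucD[OF Suc.prems(2)]; assumption)+
qed

text \<open>The chain rule gives \<open>D (g x) (E x v)\<close>, whose direction moves with
  \<open>x\<close>, while the definition of C^k speaks of fixed directions. Expanding
  \<open>E x v\<close> along \<open>Basis\<close> leaves only the fixed directions \<open>i\<close>,
  at the price of products.\<close>

lemma Ck_on_open_compose:
  assumes "open U" "open V" "g ` U \<subseteq> V" "Ck_on_open k f V" "Ck_on_open k g U"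
  shows "Ck_on_open k (\<lambda>x. f (g x)) U"
  using assms(4,5)
proof (induction k arbitrary: f)
  case 0
  then show ?case
    using assms(3) continuous_on_compose2 by auto
next
  case (Suc k)
  from Suc.prems(1) obtain D where D: "\<And>x. x \<in> V \<Longrightarrow> (f has_derivative D x) (at x)"
    "\<And>v. Ck_on_open k (\<lambda>x. D x v) V"
    by (rule Ck_on_open_SucE) blast
  from Suc.prems(2) obtain E where E: "\<And>x. x \<in> U \<Longrightarrow> (g has_derivative E x) (at x)"
    "\<And>v. Ck_on_open k (\<lambda>x. E x v) U"
    by (rule Ck_on_open_SucE) blast
  have sum_eq: "D (g x) (E x v) = (\<Sum>i\<in>Basis. inner (E x v) i *\<^sub>R D (g x) i)"
    if "x \<in> U" for x v
  proof -
    have "linear (D (g x))"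
      using D(1) that assms(3) has_derivative_linear by blast
    then have "D (g x) (\<Sum>i\<in>Basis. inner (E x v) i *\<^sub>R i)
      = (\<Sum>i\<in>Basis. inner (E x v) i *\<^sub>R D (g x) i)"
      by (simp add: linear_sum linear_scale)
    then show ?thesis by (simp add: euclidean_representation)
  qed
  show ?case
  proof (rule Ck_on_open_SucI[OF assms(1),
        where D = "\<lambda>x v. \<Sum>i\<in>Basis. inner (E x v) i *\<^sub>R D (g x) i"])
    fix x assume x: "x \<in> U"
    have "((\<lambda>x. f (g x)) has_derivative (\<lambda>v. D (g x) (E x v))) (at x)"
      using has_derivative_compose[OF E(1)[OF x] D(1)] x assms(3) by blast
    then show "((\<lambda>x. f (g x)) has_derivative
        (\<lambda>v. \<Sum>i\<in>Basis. inner (E x v) i *\<^sub>R D (g x) i)) (at x)"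
      using sum_eq[OF x] by simp
  next
    fix v
    show "Ck_on_open k (\<lambda>x. \<Sum>i\<in>Basis. inner (E x v) i *\<^sub>R D (g x) i) U"
      using Ck_on_open_linear_image[OF assms(1) bounded_linear_inner_left E(2)[of v]]
      by (intro Ck_on_open_sum[OF assms(1) finite_Basis] Ck_on_open_scaleR[OF assms(1)]
          Suc.IH D Ck_on_open_SucD[OF Suc.prems(2)])
  qed
qed

text \<open>The pair is the sum of the images of \<open>f x\<close> and \<open>g x\<close> under the
  linear embeddings into the two factors.\<close>

lemma Ck_on_open_Pair:
  assumes "open U" "Ck_on_open k f U" "Ck_on_open k g U"
  shows "Ck_on_open k (\<lambda>x. (f x, g x)) U"
  using Ck_on_open_add[OF assms(1)
      Ck_on_open_linear_image[OF assms(1)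
        bounded_linear_Pair[OF bounded_linear_ident bounded_linear_zero] assms(2)]
      Ck_on_open_linear_image[OF assms(1)
        bounded_linear_Pair[OF bounded_linear_zero bounded_linear_ident] assms(3)]]
  by simp

text \<open>The derivative contains the reciprocal again, but only its class C^k is needed there,
  which is the induction hypothesis.\<close>

lemma Ck_on_open_inverse:
  fixes f :: "'a::euclidean_space \<Rightarrow> real"
  assumes "open U" "\<And>x. x \<in> U \<Longrightarrow> f x \<noteq> 0" "Ck_on_open k f U"
  shows "Ck_on_open k (\<lambda>x. inverse (f x)) U"
  using assms(3)
proof (induction k)
  case 0
  then show ?case using assms(2) by (auto intro: continuous_on_inverse)
next
  case (Suc k)
  from Suc.prems obtain D where D: "\<And>x. x \<in> U \<Longrightarrow> (f has_derivative D x) (at x)"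
    "\<And>v. Ck_on_open k (\<lambda>x. D x v) U"
    by (rule Ck_on_open_SucE) blast
  note IH = Suc.IH[OF Ck_on_open_SucD[OF Suc.prems]]
  note scale = Ck_on_open_scaleR[OF assms(1)]
  show ?case
  proof (rule Ck_on_open_SucI[OF assms(1),
        where D = "\<lambda>x v. - (inverse (f x) * D x v * inverse (f x))"])
    show "((\<lambda>x. inverse (f x)) has_derivative
        (\<lambda>v. - (inverse (f x) * D x v * inverse (f x)))) (at x)" if "x \<in> U" for x
      using Deriv.has_derivative_inverse[OF assms(2)[OF that] D(1)[OF that]] .
    show "Ck_on_open k (\<lambda>x. - (inverse (f x) * D x v * inverse (f x))) U" for v
      using Ck_on_open_linear_image[OF assms(1) bounded_linear_minus[OF bounded_linear_ident]
          scale[OF scale[OF IH D(2)[of v]] IH]]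
      by simp
  qed
qed

section \<open>The implicit function theorem in the plane\<close>

lemma linear_real_prod:
  fixes D :: "real \<times> real \<Rightarrow> real"
  assumes "linear D"
  shows "D (u, v) = u * D (1, 0) + v * D (0, 1)"
  using linear_add[OF assms, of "(u, 0)" "(0, v)"]
    linear_scale[OF assms, of u "(1, 0)"] linear_scale[OF assms, of v "(0, 1)"]
  by simp

text \<open>Bootstrapping from mere differentiability: along the graph
  \<open>y' = - F_x / F_y\<close>, and if \<open>y\<close> is of class C^k then so is the right-hand
  side, which raises \<open>y\<close> by one class.\<close>

lemma Ck_on_open_implicit:
  fixes F :: "real \<times> real \<Rightarrow> real" and y :: "real \<Rightarrow> real"
  assumes "open W" "open I" "Ck_on_open k F W"
    and "\<And>x. x \<in> I \<Longrightarrow> (x, y x) \<in> W"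
    and "\<And>x. x \<in> I \<Longrightarrow> F (x, y x) = 0"
    and "\<And>x. x \<in> I \<Longrightarrow> frechet_derivative F (at (x, y x)) (0, 1) \<noteq> 0"
    and "\<And>x. x \<in> I \<Longrightarrow> y differentiable (at x)"
  shows "Ck_on_open k y I"
  using assms(3)
proof (induction k)
  case 0
  show ?case
    using assms(7) by (auto intro!: continuous_at_imp_continuous_on differentiable_imp_continuous_within)
next
  case (Suc k)
  define D where "D z = frechet_derivative F (at z)" for z
  have D: "(F has_derivative D z) (at z)" if "z \<in> W" for z
    using Suc.prems that by (simp add: D_def frechet_derivative_works)
  have CkD: "Ck_on_open k (\<lambda>z. D z v) W" for v
    using Suc.prems unfolding D_def Ck_on_open.simps by blast
  have "Ck_on_open k y I" using Suc.IH[OF Ck_on_open_SucD[OF Suc.prems]] .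
  then have CkP: "Ck_on_open k (\<lambda>x. (x, y x)) I"
    using Ck_on_open_Pair Ck_on_open_bounded_linear bounded_linear_ident assms(2) by blast
  have CkDy: "Ck_on_open k (\<lambda>x. D (x, y x) v) I" for v
    by (rule Ck_on_open_compose[OF assms(2,1) _ CkD CkP]) (use assms(4) in auto)
  show ?case
  proof (rule Ck_on_open_SucI[OF assms(2),
        where D = "\<lambda>x v. (- v) *\<^sub>R (inverse (D (x, y x) (0,1)) *\<^sub>R D (x, y x) (1,0))"])
    fix x assume x: "x \<in> I"
    obtain m where m: "(y has_derivative m) (at x)"
      using assms(7)[OF x] by (auto simp: differentiable_def)
    have linm: "linear m" and linD: "linear (D (x, y x))"
      using m D[OF assms(4)[OF x]] has_derivative_linear by blast+
    have "((\<lambda>x. F (x, y x)) has_derivative (\<lambda>v. D (x, y x) (v, m v))) (at x)"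
      using has_derivative_compose[OF has_derivative_Pair[OF has_derivative_ident m]
          D[OF assms(4)[OF x]]] .
    \<comment> \<open>The composite is constantly 0 on the open set \<open>I\<close>, so the
      derivative given by the chain rule must vanish; the resulting equation is solved for
      \<open>m\<close>.\<close>
    then have "((\<lambda>x. 0) has_derivative (\<lambda>v. D (x, y x) (v, m v))) (at x)"
      using Deriv.has_derivative_transform_within_open[OF _ assms(2) x] assms(5) by force
    then have zero: "D (x, y x) (v, m v) = 0" for v
      using has_derivative_unique[OF _ has_derivative_const] by metis
    have "D (x, y x) (v, m v) = v * D (x, y x) (1,0) + m v * D (x, y x) (0,1)" for v
      by (rule linear_real_prod[OF linD])
    then have "m v * D (x, y x) (0,1) = - (v * D (x, y x) (1,0))" for v
      using zero[of v] by (metis eq_neg_iff_add_eq_0 add.commute)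
    moreover have "D (x, y x) (0,1) \<noteq> 0" using assms(6)[OF x] by (simp add: D_def)
    ultimately have "m = (\<lambda>v. (- v) *\<^sub>R (inverse (D (x, y x) (0,1)) *\<^sub>R D (x, y x) (1,0)))"
      by (intro ext) (simp add: field_simps)
    then show "(y has_derivative
        (\<lambda>v. (- v) *\<^sub>R (inverse (D (x, y x) (0,1)) *\<^sub>R D (x, y x) (1,0)))) (at x)"
      using m by simp
  next
    fix v
    show "Ck_on_open k
        (\<lambda>x. (- v) *\<^sub>R (inverse (D (x, y x) (0,1)) *\<^sub>R D (x, y x) (1,0))) I"
      using assms(6)
      by (intro Ck_on_open_scaleR Ck_on_open_inverse Ck_on_open_const CkDy assms(2))
        (auto simp: D_def)
  qed
qed

text \<open>The nested eventualities let two such statements share one rectangle: first a common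
  height \<open>e\<close>, then a common width \<open>d\<close> depending on it.\<close>

lemma implicit_function_pos:
  fixes F :: "real \<times> real \<Rightarrow> real"
  assumes "open W" "(x0, y0) \<in> W" "Ck_on_open (Suc k) F W" "F (x0, y0) = 0"
    and "frechet_derivative F (at (x0, y0)) (0, 1) > 0"
  shows "\<forall>\<^sub>F e in at_right 0. \<forall>\<^sub>F d in at_right 0. ball x0 d \<times> ball y0 e \<subseteq> W \<and>
    (\<exists>y. Ck_graph_in (Suc k) {z. F z = 0} (ball x0 d) (ball y0 e) y)"
proof -
  define D where "D z = frechet_derivative F (at z)" for z
  have D: "(F has_derivative D z) (at z)" if "z \<in> W" for z
    using assms(3) that by (simp add: D_def frechet_derivative_works)
  have "Ck_on_open k (\<lambda>z. D z (0, 1)) W"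
    using assms(3) unfolding D_def Ck_on_open.simps by blast
  then have "continuous_on W (\<lambda>z. D z (0, 1))"
    by (rule Ck_on_open_imp_continuous_on)
  then have "open (W \<inter> (\<lambda>z. D z (0, 1)) -` {0<..})"
    using assms(1) continuous_on_open_vimage by (metis Int_commute open_greaterThan)
  \<comment> \<open>A product neighborhood of the point on which the partial derivative in the
    second variable stays positive.\<close>
  then obtain A B where AB: "open A" "open B" "x0 \<in> A" "y0 \<in> B"
    "A \<times> B \<subseteq> W \<inter> (\<lambda>z. D z (0, 1)) -` {0<..}"
    using assms(2,5) by (elim open_prod_elim[where x = "(x0, y0)"]) (auto simp: D_def)
  obtain r1 where r1: "r1 > 0" "ball x0 r1 \<subseteq> A" using AB openE by blast
  obtain r2 where r2: "r2 > 0" "ball y0 r2 \<subseteq> B" using AB openE by blast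
  have box: "(x, t) \<in> W" "D (x, t) (0, 1) > 0" if "x \<in> ball x0 r1" "t \<in> ball y0 r2" for x t
  proof -
    have "(x, t) \<in> A \<times> B" using that r1(2) r2(2) by blast
    then show "(x, t) \<in> W" "D (x, t) (0, 1) > 0" using AB(5) by auto
  qed
  \<comment> \<open>A ball in the reals is an interval, so the whole vertical segment from
    \<open>s\<close> to \<open>t\<close> stays where that partial derivative is positive.\<close>
  have mono: "F (x, s) < F (x, t)"
    if "x \<in> ball x0 r1" "s \<in> ball y0 r2" "t \<in> ball y0 r2" "s < t" for x s t
  proof (rule DERIV_pos_imp_increasing[OF \<open>s < t\<close>])
    fix u assume "s \<le> u" "u \<le> t"
    then have u: "u \<in> ball y0 r2" using that by (auto simp: dist_real_def)
    have "linear (D (x, u))" using D[OF box(1)] that(1) u has_derivative_linear by blast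
    then have "D (x, u) (0, v) = D (x, u) (0, 1) * v" for v
      using linear_scale[of "D (x, u)" v "(0, 1)"] by simp
    then have "(\<lambda>v. D (x, u) (0, v)) = (*) (D (x, u) (0, 1))" by (rule ext)
    moreover have "((\<lambda>u. F (x, u)) has_derivative (\<lambda>v. D (x, u) (0, v))) (at u)"
      using has_derivative_compose[OF has_derivative_Pair[OF has_derivative_const has_derivative_ident]
          D[OF box(1)[OF that(1) u]]] .
    ultimately have "DERIV (\<lambda>u. F (x, u)) u :> D (x, u) (0, 1)"
      by (simp add: has_field_derivative_def)
    then show "\<exists>z. DERIV (\<lambda>u. F (x, u)) u :> z \<and> 0 < z"
      using box(2)[OF that(1) u] by blast
  qed
  have isCont_F: "isCont F z" if "z \<in> W" for z
    using D[OF that] has_derivative_continuous by blast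
  have "\<forall>\<^sub>F d in at_right 0. ball x0 d \<times> ball y0 e \<subseteq> W \<and>
    (\<exists>y. Ck_graph_in (Suc k) {z. F z = 0} (ball x0 d) (ball y0 e) y)" if e: "0 < e" "e < r2" for e
  proof -
    \<comment> \<open>The strict bound \<open>e < r2\<close> keeps both ends of the interval inside
      the region of monotonicity.\<close>
    have "y0 - e \<in> ball y0 r2" "y0 + e \<in> ball y0 r2" "y0 \<in> ball y0 r2" "x0 \<in> ball x0 r1"
      using e r1(1) by (auto simp: dist_real_def)
    note pts = this
    have "F (x0, y0 - e) < 0" "F (x0, y0 + e) > 0"
      using mono[OF pts(4,1,3)] mono[OF pts(4,3,2)] assms(4) e by auto
    moreover have "isCont (\<lambda>x. F (x, t)) x0" if "t \<in> ball y0 r2" for t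
      using isCont_F[OF box(1)[OF pts(4) that]]
      by (intro isCont_o2[where f = "\<lambda>x. (x, t)" and g = F] continuous_intros)
    then have "((\<lambda>x. F (x, y0 - e)) \<longlongrightarrow> F (x0, y0 - e)) (at x0)"
      "((\<lambda>x. F (x, y0 + e)) \<longlongrightarrow> F (x0, y0 + e)) (at x0)"
      using pts(1,2) unfolding isCont_def by blast+
    ultimately have "\<forall>\<^sub>F x in at x0. F (x, y0 - e) < 0" "\<forall>\<^sub>F x in at x0. F (x, y0 + e) > 0"
      using order_tendstoD by blast+
    \<comment> \<open>The limits only concern \<open>x\<close> different from \<open>x0\<close>; the
      signs already known at \<open>x0\<close> itself complete the full neighborhood.\<close>
    then have "\<forall>\<^sub>F x in nhds x0. F (x, y0 - e) < 0 \<and> F (x, y0 + e) > 0"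
      using \<open>F (x0, y0 - e) < 0\<close> \<open>F (x0, y0 + e) > 0\<close>
      by (auto simp: eventually_at_filter elim: eventually_elim2)
    then obtain r3 where r3: "r3 > 0"
      "\<And>x. dist x x0 < r3 \<Longrightarrow> F (x, y0 - e) < 0 \<and> F (x, y0 + e) > 0"
      by (auto simp: eventually_nhds_metric)
    have "ball x0 d \<times> ball y0 e \<subseteq> W \<and>
      (\<exists>y. Ck_graph_in (Suc k) {z. F z = 0} (ball x0 d) (ball y0 e) y)"
      if d: "0 < d" "d < min r1 r3" for d
    proof -
      have sub: "x \<in> ball x0 r1" if "x \<in> ball x0 d" for x using that d by auto
      have sube: "t \<in> ball y0 r2" if "t \<in> cball y0 e" for t using that e by auto
      have inj: "s = t"
        if "x \<in> ball x0 d" "s \<in> ball y0 e" "t \<in> ball y0 e" "F (x, s) = F (x, t)" for x s t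
        using mono[OF sub[OF that(1)], of s t] mono[OF sub[OF that(1)], of t s]
          sube[of s] sube[of t] that by fastforce
      have "\<exists>t\<in>ball y0 e. F (x, t) = 0" if x: "x \<in> ball x0 d" for x
      proof -
        have sg: "F (x, y0 - e) < 0" "F (x, y0 + e) > 0"
          using r3(2)[of x] x d by (auto simp: dist_commute)
        have "isCont (\<lambda>t. F (x, t)) t" if "t \<in> cball y0 e" for t
          using isCont_F[OF box(1)[OF sub[OF x] sube[OF that]]]
          by (intro isCont_o2[where f = "\<lambda>t. (x, t)" and g = F] continuous_intros)
        then have "\<exists>t\<ge>y0 - e. t \<le> y0 + e \<and> F (x, t) = 0"
          using sg e by (intro IVT) (auto simp: dist_real_def)
        then obtain t where t: "y0 - e \<le> t" "t \<le> y0 + e" "F (x, t) = 0" by blast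
        \<comment> \<open>The strict signs at the ends push the zero into the open interval.\<close>
        then have "t \<noteq> y0 - e" "t \<noteq> y0 + e" using sg by auto
        then show ?thesis using t by (intro bexI[of _ t]) (auto simp: dist_real_def)
      qed
      then obtain y where y: "\<And>x. x \<in> ball x0 d \<Longrightarrow> y x \<in> ball y0 e"
        "\<And>x. x \<in> ball x0 d \<Longrightarrow> F (x, y x) = 0" by metis
      define S where "S = ball x0 d \<times> ball y0 e"
      have SW: "S \<subseteq> W" using box(1) sub sube by (auto simp: S_def)
      have "open S" by (simp add: S_def open_Times)
      \<comment> \<open>This map straightens the zero set onto the horizontal axis, so that
        differentiability of \<open>y\<close> reduces to that of an inverse map.\<close>
      define \<Phi> where "\<Phi> z = (fst z, F z)" for z
      have inj\<Phi>: "inj_on \<Phi> S"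
        using inj by (auto simp: inj_on_def \<Phi>_def S_def)
      define G where "G = inv_into S \<Phi>"
      have y_diff: "y differentiable (at x)" if x: "x \<in> ball x0 d" for x
      proof -
        define z where "z = (x, y x)"
        have z: "z \<in> S" using x y by (auto simp: z_def S_def)
        have q: "D z (0, 1) > 0" using box(2) sub[OF x] sube[of "y x"] y(1)[OF x] by (simp add: z_def)
        have linD: "linear (D z)" using D z SW has_derivative_linear by blast
        \<comment> \<open>The inverse of the linear map \<open>(u, v)\<close> to
          \<open>(u, D z (u, v))\<close>, found by solving for \<open>v\<close>.\<close>
        define G' where "G' w = (fst w, (snd w - fst w * D z (1, 0)) / D z (0, 1))" for w
        have split: "D z (u, v) = u * D z (1, 0) + v * D z (0, 1)" for u v
          by (rule linear_real_prod[OF linD])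
        have "(G has_derivative G') (at (\<Phi> z))"
        proof (rule has_derivative_inverse_strong[OF \<open>open S\<close> z])
          show "continuous_on S \<Phi>"
            using isCont_F SW unfolding \<Phi>_def
            by (intro continuous_on_Pair continuous_on_fst continuous_on_id
                continuous_at_imp_continuous_on) auto
          show "G (\<Phi> z) = z" if "z \<in> S" for z
            using inj\<Phi> that by (simp add: G_def)
          show "(\<Phi> has_derivative (\<lambda>v. (fst v, D z v))) (at z)"
            unfolding \<Phi>_def using D[OF subsetD[OF SW z]]
            by (intro has_derivative_Pair has_derivative_fst has_derivative_ident)
          show "(\<lambda>v. (fst v, D z v)) \<circ> G' = id"
          proof
            fix w
            have "D z (G' w) = snd w" unfolding G'_def split[of "fst w"] using q by simp
            then show "((\<lambda>v. (fst v, D z v)) \<circ> G') w = id w"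
              by (simp add: prod_eq_iff) (simp add: G'_def)
          qed
        qed
        moreover have "\<Phi> z = (x, 0)" using y(2)[OF x] by (simp add: \<Phi>_def z_def)
        ultimately have "((\<lambda>x. G (x, 0)) has_derivative (\<lambda>v. G' (v, 0))) (at x)"
          using has_derivative_compose[OF has_derivative_Pair[OF has_derivative_ident has_derivative_const],
              of G G' x 0] by simp
        then have "((\<lambda>x. snd (G (x, 0))) has_derivative (\<lambda>v. snd (G' (v, 0)))) (at x)"
          by (rule has_derivative_snd)
        \<comment> \<open>\<open>\<Phi>\<close> sends \<open>(x', y x')\<close> to
          \<open>(x', 0)\<close>, so \<open>y\<close> is the second coordinate of \<open>G\<close>
          along the axis.\<close>
        moreover have "snd (G (x', 0)) = y x'" if "x' \<in> ball x0 d" for x'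
        proof -
          have "G (\<Phi> (x', y x')) = (x', y x')"
            using inj\<Phi> y(1)[OF that] that by (simp add: G_def S_def)
          then show ?thesis using y(2)[OF that] by (simp add: \<Phi>_def)
        qed
        ultimately have "(y has_derivative (\<lambda>v. snd (G' (v, 0)))) (at x)"
          using Deriv.has_derivative_transform_within_open[OF _ open_ball x] by blast
        then show ?thesis by (auto simp: differentiable_def)
      qed
      have "Ck_on_open (Suc k) y (ball x0 d)"
      proof (rule Ck_on_open_implicit[OF assms(1) open_ball assms(3)])
        fix x assume x: "x \<in> ball x0 d"
        show "(x, y x) \<in> W" using SW y(1)[OF x] x by (auto simp: S_def)
        show "F (x, y x) = 0" using y(2)[OF x] .
        show "frechet_derivative F (at (x, y x)) (0, 1) \<noteq> 0"
          using box(2)[OF sub[OF x] sube[of "y x"]] y(1)[OF x] by (simp add: D_def)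
        show "y differentiable (at x)" using y_diff[OF x] .
      qed
      moreover have "{z. F z = 0} \<inter> (ball x0 d \<times> ball y0 e) = {(x, y x) |x. x \<in> ball x0 d}"
        using y inj by fastforce
      ultimately show ?thesis using SW unfolding Ck_graph_in_def S_def by blast
    qed
    then show ?thesis
      using r1(1) r3(1) unfolding eventually_at_right_field
      by (intro exI[of _ "min r1 r3"]) simp
  qed
  then show ?thesis
    using r2(1) unfolding eventually_at_right_field by (intro exI[of _ r2]) simp
qed

text \<open>Passing from \<open>F\<close> to its negative keeps the zero set and the class but
  reverses the sign of the partial derivative, so the positive case suffices.\<close>

lemma implicit_function:
  fixes F :: "real \<times> real \<Rightarrow> real"
  assumes "open W" "(x0, y0) \<in> W" "Ck_on_open (Suc k) F W" "F (x0, y0) = 0"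
    and "frechet_derivative F (at (x0, y0)) (0, 1) \<noteq> 0"
  shows "\<forall>\<^sub>F e in at_right 0. \<forall>\<^sub>F d in at_right 0. ball x0 d \<times> ball y0 e \<subseteq> W \<and>
    (\<exists>y. Ck_graph_in (Suc k) {z. F z = 0} (ball x0 d) (ball y0 e) y)"
proof (cases "frechet_derivative F (at (x0, y0)) (0, 1) > 0")
  case True
  then show ?thesis using implicit_function_pos assms by blast
next
  case False
  have "(F has_derivative frechet_derivative F (at (x0, y0))) (at (x0, y0))"
    using assms(2,3) by (simp add: frechet_derivative_works)
  from frechet_derivative_at[OF has_derivative_minus[OF this]]
  have "frechet_derivative (\<lambda>z. - F z) (at (x0, y0)) (0, 1) > 0"
    using False assms(5) by (metis linorder_neqE neg_0_less_iff_less)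
  moreover have "Ck_on_open (Suc k) (\<lambda>z. - F z) W"
    using Ck_on_open_linear_image[OF assms(1) bounded_linear_minus[OF bounded_linear_ident] assms(3)] .
  ultimately show ?thesis
    using implicit_function_pos[OF assms(1,2), of k "\<lambda>z. - F z"] assms(4) by simp
qed

section \<open>Slopes of the critical curves and partial derivatives\<close>

text \<open>Differentiating \<open>F (x, y x) = 0\<close> at \<open>x0\<close> by the chain rule.
  The rectangle and the graph function are arbitrary, so the slope does not depend on how the graph
  was found.\<close>

lemma Ck_graph_in_deriv:
  assumes "(F has_derivative D) (at (x0, y0))" "Ck_graph_in (Suc k) C I J y"
    and "open I" "x0 \<in> I" "y0 \<in> J" "(x0, y0) \<in> C" "\<And>z. z \<in> C \<Longrightarrow> F z = (0::real)"
  shows "D (1, 0) + deriv y x0 * D (0, 1) = 0"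
proof -
  have graph: "C \<inter> (I \<times> J) = {(x, y x) |x. x \<in> I}" and "Ck_on_open (Suc k) y I"
    using assms(2) by (auto simp: Ck_graph_in_def)
  then have "(y has_real_derivative deriv y x0) (at x0)"
    using assms(4) DERIV_deriv_iff_real_differentiable by auto
  then have y: "(y has_derivative (\<lambda>v. deriv y x0 * v)) (at x0)"
    by (simp add: has_field_derivative_def)
  have "(x0, y0) \<in> {(x, y x) |x. x \<in> I}" unfolding graph[symmetric] using assms(4-6) by simp
  then have "y x0 = y0" by auto
  then have "((\<lambda>x. F (x, y x)) has_derivative (\<lambda>v. D (v, deriv y x0 * v))) (at x0)"
    using has_derivative_compose[OF has_derivative_Pair[OF has_derivative_ident y], of F D] assms(1)
    by simp
  moreover have "F (x, y x) = 0" if "x \<in> I" for x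
  proof -
    have "(x, y x) \<in> C \<inter> (I \<times> J)" unfolding graph using that by auto
    then show ?thesis using assms(7) by blast
  qed
  ultimately have "((\<lambda>x. 0) has_derivative (\<lambda>v. D (v, deriv y x0 * v))) (at x0)"
    using Deriv.has_derivative_transform_within_open[where f = "\<lambda>x. F (x, y x)" and g = "\<lambda>x. 0",
        OF _ assms(3,4)] by blast
  then have "D (1, deriv y x0) = 0"
    using has_derivative_unique[OF _ has_derivative_const] by (metis mult.right_neutral)
  moreover have "linear D" using assms(1) has_derivative_linear by blast
  ultimately show ?thesis
    using linear_real_prod[of D 1 "deriv y x0"] by simp
qed

text \<open>Links the one-variable derivatives in which the hypotheses are stated to the total
  derivative used for the chain rule.\<close>

lemma partial_x_eq:
  assumes "(f has_derivative D) (at z)"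
  shows "partial_x f z = D (1, 0)"
proof -
  have "((\<lambda>x. f (x, snd z)) has_derivative (\<lambda>v. D (v, 0))) (at (fst z))"
    using has_derivative_compose[OF has_derivative_Pair[OF has_derivative_ident has_derivative_const],
        of f D "fst z" "snd z"] assms by simp
  moreover have "D (v, 0) = D (1, 0) * v" for v
    using linear_scale[OF has_derivative_linear[OF assms], of v "(1, 0)"] by simp
  then have "(\<lambda>v. D (v, 0)) = (*) (D (1, 0))" by (rule ext)
  ultimately show ?thesis
    unfolding partial_x_def by (intro DERIV_imp_deriv) (simp add: has_field_derivative_def)
qed

lemma partial_y_eq:
  assumes "(f has_derivative D) (at z)"
  shows "partial_y f z = D (0, 1)"
proof -
  have "((\<lambda>y. f (fst z, y)) has_derivative (\<lambda>v. D (0, v))) (at (snd z))"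
    using has_derivative_compose[OF has_derivative_Pair[OF has_derivative_const has_derivative_ident],
        of f D "fst z" "snd z"] assms by simp
  moreover have "D (0, v) = D (0, 1) * v" for v
    using linear_scale[OF has_derivative_linear[OF assms], of v "(0, 1)"] by simp
  then have "(\<lambda>v. D (0, v)) = (*) (D (0, 1))" by (rule ext)
  ultimately show ?thesis
    unfolding partial_y_def by (intro DERIV_imp_deriv) (simp add: has_field_derivative_def)
qed

section \<open>Eigenvalues of a real two by two matrix\<close>

lemma det_two:
  assumes "(A :: 'a::comm_ring_1 mat) \<in> carrier_mat 2 2"
  shows "Determinant.det A = A $$ (0,0) * A $$ (1,1) - A $$ (0,1) * A $$ (1,0)"
proof -
  \<comment> \<open>Deleting row 0 and column \<open>j\<close> leaves the single entry in row 1 and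
    the other column, \<open>1 - j\<close>.\<close>
  have "Determinant.det (mat_delete A 0 j) = A $$ (1, 1 - j)" if "j < 2" for j
    using assms that by (subst det_single) (auto simp: mat_delete_def)
  then show ?thesis
    using laplace_expansion_row[OF assms, of 0]
    by (simp add: cofactor_def numeral_2_eq_2)
qed

text \<open>This is the characteristic equation, from the vanishing of the determinant of the
  characteristic matrix.\<close>

lemma complex_eigenvalues_two:
  "complex_eigenvalues (mat_of_rows_list 2 [[a, b], [c, d]]) =
    {\<mu>. (\<mu> - of_real a) * (\<mu> - of_real d) = of_real (b * c)}"
proof -
  let ?A = "map_mat complex_of_real (mat_of_rows_list 2 [[a, b], [c, d]])"
  have A: "?A \<in> carrier_mat 2 2" by (auto simp: mat_of_rows_list_def)
  have "eigenvalue ?A \<mu> \<longleftrightarrow> (\<mu> - of_real a) * (\<mu> - of_real d) = of_real (b * c)" for \<mu>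
    unfolding eigenvalue_det[OF A]
    by (subst det_two) (auto simp: char_matrix_def mat_of_rows_list_def algebra_simps)
  then show ?thesis by (simp add: complex_eigenvalues_def)
qed

lemma dominant_eigenvalue:
  fixes a b c d :: real
  assumes "0 < a" "a < 1" "b * c > 0" "0 < d" "d < 1" "1 + (a + d) + a * d - b * c > 0"
  obtains l1 l2 where
    "complex_eigenvalues (mat_of_rows_list 2 [[a, b], [c, d]]) = {complex_of_real l1, complex_of_real l2}"
    "l2 < l1" "\<bar>l2\<bar> < \<bar>l1\<bar>" "0 < l1" "-1 < l2" "l2 < 1"
    "(1 - l1) * (1 - l2) = (1 - a) * (1 - d) - b * c"
proof -
  \<comment> \<open>The square root of the discriminant of the characteristic polynomial; it is
    positive because \<open>b * c > 0\<close>.\<close>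
  define s where "s = sqrt ((a - d)\<^sup>2 + 4 * (b * c))"
  define l1 where "l1 = (a + d + s) / 2"
  define l2 where "l2 = (a + d - s) / 2"
  have s: "s > 0" "s\<^sup>2 = (a - d)\<^sup>2 + 4 * (b * c)"
    using assms(3) by (simp_all add: s_def add_nonneg_pos)
  have sum: "l1 + l2 = a + d" by (simp add: l1_def l2_def field_simps)
  have "l1 * l2 = ((a + d)\<^sup>2 - s\<^sup>2) / 4"
    by (simp add: l1_def l2_def power2_eq_square field_simps)
  also have "\<dots> = a * d - b * c"
    unfolding s(2) by (simp add: power2_eq_square field_simps)
  finally have prod: "l1 * l2 = a * d - b * c" .
  have lt: "l2 < l1" using s(1) by (simp add: l1_def l2_def)
  \<comment> \<open>The last hypothesis is the value of the characteristic polynomial at -1. As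
    \<open>1 + l1\<close> is positive, so is \<open>1 + l2\<close>.\<close>
  have "(1 + l1) * (1 + l2) > 0"
    using assms(6) sum prod by (simp add: algebra_simps)
  moreover have "l1 > 0" using s(1) assms by (simp add: l1_def)
  ultimately have "-1 < l2" by (simp add: zero_less_mult_iff)
  have roots: "(\<mu> - of_real a) * (\<mu> - of_real d) = of_real (b * c) \<longleftrightarrow>
      \<mu> = of_real l1 \<or> \<mu> = of_real l2" for \<mu> :: complex
  proof -
    have "(\<mu> - of_real a) * (\<mu> - of_real d) - of_real (b * c) =
        \<mu> * \<mu> - of_real (a + d) * \<mu> + of_real (a * d - b * c)"
      by (simp add: algebra_simps)
    also have "\<dots> = (\<mu> - of_real l1) * (\<mu> - of_real l2)"
      unfolding sum[symmetric] prod[symmetric] by (simp add: algebra_simps)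
    finally show ?thesis by (metis eq_iff_diff_eq_0 mult_eq_0_iff)
  qed
  show ?thesis
  proof (rule that[of l1 l2])
    show "complex_eigenvalues (mat_of_rows_list 2 [[a, b], [c, d]]) = {of_real l1, of_real l2}"
      unfolding complex_eigenvalues_two roots by auto
    \<comment> \<open>A positive sum \<open>a + d\<close> rules out that the smaller root has the
      larger absolute value.\<close>
    show "\<bar>l2\<bar> < \<bar>l1\<bar>" using lt sum assms(1,4) by linarith
    \<comment> \<open>The smaller root lies below the mean \<open>(a + d) / 2\<close>, which is less
      than 1.\<close>
    show "l2 < 1" using lt sum assms by linarith
    show "(1 - l1) * (1 - l2) = (1 - a) * (1 - d) - b * c"
      using sum prod by (simp add: algebra_simps)
  qed fact+
qed

section \<open>Critical curves at the fixed point and the position of the dominant eigenvalue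
  relative to 1\<close>

theorem theorem1:
  fixes R C1 C2 :: "(real \<times> real) set"
    and f g :: "real \<times> real \<Rightarrow> real"
    and T :: "real \<times> real \<Rightarrow> real \<times> real"
    and p :: nat
    and xb yb a b c d :: real
  assumes "interior R \<noteq> {}"
    and "T = (\<lambda>z. (f z, g z))"
    and "T ` R \<subseteq> R"
    and "p \<ge> 1"
    and "Ck_on p T R"
    and "(xb, yb) \<in> interior R"
    and "T (xb, yb) = (xb, yb)"
    and "a = partial_x f (xb, yb)"
    and "b = partial_y f (xb, yb)"
    and "c = partial_x g (xb, yb)"
    and "d = partial_y g (xb, yb)"
    and "0 < a" and "a < 1"
    and "b * c > 0"
    and "0 < d" and "d < 1"
    and "1 + (a + d) + a * d - b * c > 0"
    and "C1 = {(x, y). (x, y) \<in> R \<and> x = f (x, y)}"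
    and "C2 = {(x, y). (x, y) \<in> R \<and> y = g (x, y)}"
  shows "(\<exists>I J y1 y2. open I \<and> xb \<in> I \<and> open J \<and> yb \<in> J \<and>
            Ck_graph_in p C1 I J y1 \<and> Ck_graph_in p C2 I J y2) \<and>
         (\<exists>l1 l2 :: real.
            complex_eigenvalues (jacobian_matrix T (xb, yb)) =
              {complex_of_real l1, complex_of_real l2} \<and>
            l2 < l1 \<and> \<bar>l2\<bar> < \<bar>l1\<bar> \<and> 0 < l1 \<and>
            -1 < l2 \<and> l2 < 1 \<and>
            (\<forall>I J y1 y2. open I \<and> xb \<in> I \<and> open J \<and> yb \<in> J \<and>
               Ck_graph_in p C1 I J y1 \<and> Ck_graph_in p C2 I J y2 \<longrightarrow>
               (b > 0 \<longrightarrow> sgn (l1 - 1) = - sgn (deriv y1 xb - deriv y2 xb)) \<and>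
               (b < 0 \<longrightarrow> sgn (l1 - 1) = sgn (deriv y1 xb - deriv y2 xb))))"
proof -
  obtain k where p: "p = Suc k" using assms(4) by (cases p) auto
  obtain U h where U: "open U" "(xb, yb) \<in> U" "Ck_on_open p h U"
    and h: "\<And>z. z \<in> R \<inter> U \<Longrightarrow> h z = T z"
    using assms(5) subsetD[OF interior_subset assms(6)] unfolding Ck_on_def by metis
  \<comment> \<open>On this open set the local extension \<open>h\<close> coincides with
    \<open>T\<close>, so \<open>T\<close> itself is of class C^p there.\<close>
  define W where "W = U \<inter> interior R"
  have W: "open W" "(xb, yb) \<in> W" "W \<subseteq> R"
    using U(1,2) assms(6) interior_subset by (auto simp: W_def)
  have "Ck_on_open p T W"
    using Ck_on_open_cong[OF W(1) _ Ck_on_open_subset[OF U(3)], of T] h interior_subset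
    by (auto simp: W_def)
  from Ck_on_open_linear_image[OF W(1) bounded_linear_fst this]
    Ck_on_open_linear_image[OF W(1) bounded_linear_snd this]
  have Ckf: "Ck_on_open p f W" and Ckg: "Ck_on_open p g W"
    by (simp_all add: assms(2))
  obtain Df Dg where Df: "(f has_derivative Df) (at (xb, yb))"
    and Dg: "(g has_derivative Dg) (at (xb, yb))"
    using Ckf Ckg W(2) unfolding p Ck_on_open.simps differentiable_def by blast
  have abcd: "a = Df (1, 0)" "b = Df (0, 1)" "c = Dg (1, 0)" "d = Dg (0, 1)"
    using assms(8-11) partial_x_eq partial_y_eq Df Dg by auto
  \<comment> \<open>The critical sets are the zero sets of \<open>F1\<close> and \<open>F2\<close>
    in \<open>R\<close>; the partial derivatives in \<open>y\<close> at the fixed point are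
    \<open>b\<close> and \<open>d - 1\<close>, both nonzero.\<close>
  define F1 where "F1 z = f z - fst z" for z
  define F2 where "F2 z = g z - snd z" for z
  have DF1: "(F1 has_derivative (\<lambda>v. Df v - fst v)) (at (xb, yb))"
    unfolding F1_def using Df by (intro has_derivative_diff has_derivative_fst has_derivative_ident)
  have DF2: "(F2 has_derivative (\<lambda>v. Dg v - snd v)) (at (xb, yb))"
    unfolding F2_def using Dg by (intro has_derivative_diff has_derivative_snd has_derivative_ident)
  have fp: "f (xb, yb) = xb" "g (xb, yb) = yb" using assms(2,7) by auto
  have bd: "b \<noteq> 0" "d \<noteq> 1" using assms(14,16) by auto
  have C1: "C1 = {z \<in> R. F1 z = 0}" and C2: "C2 = {z \<in> R. F2 z = 0}"
    by (auto simp: assms(18,19) F1_def F2_def)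
  have CkF: "Ck_on_open (Suc k) F1 W"
    using Ckf unfolding F1_def p
    by (rule Ck_on_open_diff[OF W(1) _ Ck_on_open_bounded_linear[OF W(1) bounded_linear_fst]])
  have CkG: "Ck_on_open (Suc k) F2 W"
    using Ckg unfolding F2_def p
    by (rule Ck_on_open_diff[OF W(1) _ Ck_on_open_bounded_linear[OF W(1) bounded_linear_snd]])
  have "\<forall>\<^sub>F e in at_right 0. \<forall>\<^sub>F d in at_right 0. ball xb d \<times> ball yb e \<subseteq> W \<and>
      (\<exists>y. Ck_graph_in (Suc k) {z. F1 z = 0} (ball xb d) (ball yb e) y)"
    using implicit_function[OF W(1,2) CkF] frechet_derivative_at[OF DF1, symmetric] fp(1) abcd bd
    by (simp add: F1_def)
  moreover have "\<forall>\<^sub>F e in at_right 0. \<forall>\<^sub>F d in at_right 0. ball xb d \<times> ball yb e \<subseteq> W \<and>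
      (\<exists>y. Ck_graph_in (Suc k) {z. F2 z = 0} (ball xb d) (ball yb e) y)"
    using implicit_function[OF W(1,2) CkG] frechet_derivative_at[OF DF2, symmetric] fp(2) abcd bd
    by (simp add: F2_def)
  \<comment> \<open>Both curves are put over one rectangle; positivity of \<open>e\<close> and of
    the width is carried along so that the balls are neighborhoods.\<close>
  ultimately have "\<forall>\<^sub>F e in at_right (0::real). 0 < e \<and> (\<forall>\<^sub>F d in at_right 0. 0 < d \<and>
      ball xb d \<times> ball yb e \<subseteq> W \<and>
      (\<exists>y. Ck_graph_in (Suc k) {z. F1 z = 0} (ball xb d) (ball yb e) y) \<and>
      (\<exists>y. Ck_graph_in (Suc k) {z. F2 z = 0} (ball xb d) (ball yb e) y))"
    using eventually_at_right_less[of "0::real"]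
  proof eventually_elim
    case (elim e)
    from eventually_at_right_less[of "0::real"] elim(1,2)
    have "\<forall>\<^sub>F d in at_right 0. 0 < d \<and> ball xb d \<times> ball yb e \<subseteq> W \<and>
        (\<exists>y. Ck_graph_in (Suc k) {z. F1 z = 0} (ball xb d) (ball yb e) y) \<and>
        (\<exists>y. Ck_graph_in (Suc k) {z. F2 z = 0} (ball xb d) (ball yb e) y)"
      by eventually_elim blast
    then show ?case using elim(3) by blast
  qed
  from eventually_happens[OF this] obtain e where e: "e > 0"
    "\<forall>\<^sub>F d in at_right 0. 0 < d \<and> ball xb d \<times> ball yb e \<subseteq> W \<and>
      (\<exists>y. Ck_graph_in (Suc k) {z. F1 z = 0} (ball xb d) (ball yb e) y) \<and>
      (\<exists>y. Ck_graph_in (Suc k) {z. F2 z = 0} (ball xb d) (ball yb e) y)" by auto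
  from eventually_happens[OF e(2)] obtain r y1 y2 where r: "r > 0" "ball xb r \<times> ball yb e \<subseteq> W"
    and y: "Ck_graph_in (Suc k) {z. F1 z = 0} (ball xb r) (ball yb e) y1"
      "Ck_graph_in (Suc k) {z. F2 z = 0} (ball xb r) (ball yb e) y2" by auto
  \<comment> \<open>The rectangle lies in \<open>R\<close>, so inside it the restriction to
    \<open>R\<close> in the critical sets has no effect.\<close>
  have "C1 \<inter> (ball xb r \<times> ball yb e) = {z. F1 z = 0} \<inter> (ball xb r \<times> ball yb e)"
    "C2 \<inter> (ball xb r \<times> ball yb e) = {z. F2 z = 0} \<inter> (ball xb r \<times> ball yb e)"
    using r(2) W(3) unfolding C1 C2 by blast+
  then have "Ck_graph_in p C1 (ball xb r) (ball yb e) y1" "Ck_graph_in p C2 (ball xb r) (ball yb e) y2"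
    using y by (simp_all add: Ck_graph_in_def p)
  then have i: "\<exists>I J y1 y2. open I \<and> xb \<in> I \<and> open J \<and> yb \<in> J \<and>
      Ck_graph_in p C1 I J y1 \<and> Ck_graph_in p C2 I J y2"
    using e(1) r(1) by (meson centre_in_ball open_ball)
  have jac: "jacobian_matrix T (xb, yb) = mat_of_rows_list 2 [[a, b], [c, d]]"
    by (simp add: jacobian_matrix_def assms(2,8-11))
  obtain l1 l2 where
    l: "complex_eigenvalues (mat_of_rows_list 2 [[a, b], [c, d]]) = {complex_of_real l1, complex_of_real l2}"
      "l2 < l1" "\<bar>l2\<bar> < \<bar>l1\<bar>" "0 < l1" "-1 < l2" "l2 < 1"
    and char: "(1 - l1) * (1 - l2) = (1 - a) * (1 - d) - b * c"
    using dominant_eigenvalue[OF assms(12-17)] by blast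
  \<comment> \<open>The sign rule is shown for every admissible rectangle and pair of graphs, not
    just for those constructed above.\<close>
  have "(b > 0 \<longrightarrow> sgn (l1 - 1) = - sgn (deriv y1 xb - deriv y2 xb)) \<and>
      (b < 0 \<longrightarrow> sgn (l1 - 1) = sgn (deriv y1 xb - deriv y2 xb))"
    if I: "open I" "xb \<in> I" "open J" "yb \<in> J"
      and graphs: "Ck_graph_in p C1 I J y1" "Ck_graph_in p C2 I J y2" for I J y1 y2
  proof -
    have inC: "(xb, yb) \<in> C1" "(xb, yb) \<in> C2"
      using W fp by (auto simp: C1 C2 F1_def F2_def)
    have "(a - 1) + deriv y1 xb * b = 0"
      using Ck_graph_in_deriv[OF DF1 graphs(1)[unfolded p] I(1,2,4) inC(1)] abcd
      by (simp add: C1)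
    moreover have "c + deriv y2 xb * (d - 1) = 0"
      using Ck_graph_in_deriv[OF DF2 graphs(2)[unfolded p] I(1,2,4) inC(2)] abcd
      by (simp add: C2)
    ultimately have "deriv y1 xb * b = 1 - a" "deriv y2 xb * (1 - d) = c"
      by (simp_all add: algebra_simps)
    \<comment> \<open>Substituting the slopes turns \<open>(1 - a) * (1 - d)\<close> and
      \<open>b * c\<close> into multiples of \<open>b * (1 - d)\<close>.\<close>
    then have "(1 - l1) * (1 - l2) = (deriv y1 xb - deriv y2 xb) * (b * (1 - d))"
      unfolding char by (metis (no_types, opaque_lifting) left_diff_distrib mult.assoc mult.commute)
    then have "sgn (1 - l1) * sgn (1 - l2) =
        sgn (deriv y1 xb - deriv y2 xb) * (sgn b * sgn (1 - d))"
      by (metis sgn_mult)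
    \<comment> \<open>Both \<open>1 - l2\<close> and \<open>1 - d\<close> are positive and drop out.
      Hence \<open>l1 - 1\<close> has the sign opposite to the slope difference for positive
      \<open>b\<close> and the same sign for negative \<open>b\<close>.\<close>
    then have "sgn (1 - l1) = sgn (deriv y1 xb - deriv y2 xb) * sgn b"
      using l(6) assms(16) by simp
    moreover have "sgn (l1 - 1) = - sgn (1 - l1)"
      by (metis minus_diff_eq sgn_minus)
    ultimately show ?thesis by auto
  qed
  note signs = this
  show ?thesis
  proof (rule conjI[OF i], rule exI[of _ l1], rule exI[of _ l2], intro conjI allI)
    show "complex_eigenvalues (jacobian_matrix T (xb, yb)) = {complex_of_real l1, complex_of_real l2}"
      using l(1) jac by simp
  qed (use l signs in blast)+
qed

end
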